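(* Let $f(X)$ be a non-constant polynomial with integer coefficients which has no roots in some sector $S_{v,\theta}$ with $v\in\mathbb{R}$ and $0<\theta\le\frac{\pi}{2}$. If $f(m)=pq$ with $p$ a prime number, $q$ and $m$ integers, $q>0$ and $m>v+\frac{q}{\sin\theta}$, then $f$ is irreducible over $\mathbb{Q}$. Moreover, if $f$ has no rational roots, the same conclusion holds if $m>v+\frac{\sqrt q}{\sin\theta}$ (in place of $m>v+\frac{q}{\sin\theta}$).
   Context: For real numbers $v,\theta$ with $0<\theta<\pi$, define the open sector $S_{v,\theta}=\{z=v+\rho e^{i\varphi}\in\mathbb{C}:\rho>0,\ |\varphi|<\theta\}$ (with $\varphi$ real). *)

theory Defs
  imports Complex_Main "HOL-Computational_Algebra.Computational_Algebra"
begin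

(* The apex v is not in the sector. The intended range of the opening is 0 < \<theta> < pi. *)
definition sector :: "real \<Rightarrow> real \<Rightarrow> complex set" where
  "sector v \<theta> =
     {complex_of_real v + complex_of_real \<rho> * exp (\<i> * complex_of_real \<phi>) |\<rho> \<phi>.
        \<rho> > 0 \<and> \<bar>\<phi>\<bar> < \<theta>}"

end

theory Submission
  imports Defs
begin

text \<open>
  A point outside the sector is at distance at least \<open>(m - v) sin \<theta>\<close> from \<open>m\<close>, so all roots of \<open>f\<close>
  are farther than \<open>q\<close> (resp. \<open>sqrt q\<close>) from \<open>m\<close>. If \<open>f = g h\<close> is a proper factorisation, which by
  Gauss' lemma may be taken over the integers, then \<open>p\<close> divides one of \<open>g(m)\<close>, \<open>h(m)\<close>, and the other
  one is at most \<open>q\<close> in absolute value. But that value is at least the product of the distances of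
  \<open>m\<close> to the roots of the factor, hence greater than \<open>q\<close>; in the second case because the factor has
  at least two roots.
\<close>

text \<open>With \<open>d = x - v\<close> and \<open>w = z - v\<close> in polar form, the law of
  cosines gives the squared distance as \<open>d^2 - 2 d r cos \<phi> + r^2\<close>. Away from the
  apex, lying outside the sector forces \<bar>\<phi>\<bar> \<ge> \<theta>, so cos \<phi> may be
  replaced by cos \<theta>; the rest is a minimisation over \<open>r\<close>.\<close>

lemma dist_outside_sector:
  assumes "x > v" and "0 < \<theta>" and "\<theta> \<le> pi" and "z \<notin> sector v \<theta>"
  shows "(x - v) * sin \<theta> \<le> cmod (of_real x - z)"
proof -
  define w where "w = z - of_real v"
  define r \<phi> d where "r = cmod w" and "\<phi> = Arg w" and "d = x - v"
  have w: "w = of_real r * exp (\<i> * of_real \<phi>)"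
    by (cases "w = 0") (simp_all add: r_def \<phi>_def rcis_cmod_Arg flip: rcis_def cis_conv_exp)
  have "d > 0" "r \<ge> 0" using assms by (simp_all add: d_def r_def)
  have "w = rcis r \<phi>" by (simp add: w rcis_def cis_conv_exp)
  hence "of_real d - w = Complex (d - r * cos \<phi>) (- (r * sin \<phi>))"
    by (simp add: complex_eq_iff)
  hence "(cmod (of_real d - w))\<^sup>2 = (d - r * cos \<phi>)\<^sup>2 + (r * sin \<phi>)\<^sup>2"
    by (simp add: cmod_power2)
  also have "\<dots> = d\<^sup>2 - 2 * d * (r * cos \<phi>) + r\<^sup>2 * ((sin \<phi>)\<^sup>2 + (cos \<phi>)\<^sup>2)"
    by algebra
  also have "\<dots> = d\<^sup>2 - 2 * d * (r * cos \<phi>) + r\<^sup>2"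
    by simp
  finally have dist: "(cmod (of_real d - w))\<^sup>2 = d\<^sup>2 - 2 * d * (r * cos \<phi>) + r\<^sup>2" .
  \<comment> \<open>The apex \<open>r = 0\<close> is treated apart: it lies outside the sector
    whatever angle \<open>Arg\<close> assigns to it, and both sides vanish.\<close>
  have "r * cos \<phi> \<le> r * cos \<theta>"
  proof (cases "r = 0")
    case False
    have "\<theta> \<le> \<bar>\<phi>\<bar>"
    proof (rule ccontr)
      assume "\<not> \<theta> \<le> \<bar>\<phi>\<bar>"
      hence "z \<in> sector v \<theta>"
        using False \<open>r \<ge> 0\<close> w unfolding sector_def w_def
        by (intro CollectI exI[of _ r] exI[of _ \<phi>]) (auto simp: diff_eq_eq add.commute)
      with assms show False by simp
    qed
    moreover have "\<bar>\<phi>\<bar> \<le> pi" using Arg_bounded[of w] by (auto simp: \<phi>_def)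
    ultimately have "cos \<bar>\<phi>\<bar> \<le> cos \<theta>"
      using assms by (intro cos_monotone_0_pi_le) auto
    thus ?thesis using \<open>r \<ge> 0\<close> by (simp add: mult_left_mono)
  qed simp
  hence "2 * d * (r * cos \<phi>) \<le> 2 * d * (r * cos \<theta>)"
    using \<open>d > 0\<close> by simp
  hence "(cmod (of_real d - w))\<^sup>2 \<ge> d\<^sup>2 - 2 * d * (r * cos \<theta>) + r\<^sup>2"
    using dist by simp
  \<comment> \<open>Completing the square in \<open>r\<close>: the minimum is at
    \<open>r = d * cos \<theta>\<close>, the foot of the perpendicular from \<open>x\<close> to the
    line carrying the boundary ray.\<close>
  moreover have "d\<^sup>2 - 2 * d * (r * cos \<theta>) + r\<^sup>2 = (r - d * cos \<theta>)\<^sup>2 + (d * sin \<theta>)\<^sup>2"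
  proof -
    have "(r - d * cos \<theta>)\<^sup>2 + (d * sin \<theta>)\<^sup>2
            = r\<^sup>2 - 2 * d * (r * cos \<theta>) + d\<^sup>2 * ((sin \<theta>)\<^sup>2 + (cos \<theta>)\<^sup>2)"
      by algebra
    thus ?thesis by simp
  qed
  ultimately have "(d * sin \<theta>)\<^sup>2 \<le> (cmod (of_real d - w))\<^sup>2"
    using zero_le_power2[of "r - d * cos \<theta>"] by linarith
  hence "d * sin \<theta> \<le> cmod (of_real d - w)"
    by (rule power2_le_imp_le) simp
  thus ?thesis by (simp add: d_def w_def)
qed

lemma prod_mset_norm_gt:
  fixes c :: complex and A :: "complex multiset"
  assumes "r \<ge> 1" and "\<And>z. z \<in># A \<Longrightarrow> cmod (c - z) > r" and "A \<noteq> {#}"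
  shows "(\<Prod>z\<in>#A. cmod (c - z)) > r ^ size A"
  using assms
proof (induction A)
  case (add x A)
  have x: "cmod (c - x) > r" using add.prems by simp
  \<comment> \<open>The induction hypothesis covers only nonempty \<open>A\<close>; the empty
    product equals \<open>r ^ 0\<close>. Strictness then comes from the new factor.\<close>
  have "(\<Prod>z\<in>#A. cmod (c - z)) \<ge> r ^ size A"
    using add by (cases "A = {#}") (auto intro: less_imp_le)
  moreover have "r ^ size A > 0" using \<open>r \<ge> 1\<close> by simp
  ultimately have "r * r ^ size A < cmod (c - x) * (\<Prod>z\<in>#A. cmod (c - z))"
    using x \<open>r \<ge> 1\<close> by (intro mult_strict_left_mono mult_less_le_imp_less) auto
  thus ?case by simp
qed simp

text \<open>Over the complex numbers \<open>g\<close> splits into linear factors, so its value at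
  \<open>m\<close> is the leading coefficient times the product of the differences
  \<open>m - z\<close> over the roots. The leading coefficient is a nonzero integer and cannot make
  this product smaller.\<close>

lemma abs_poly_gt_power:
  fixes g :: "int poly" and m :: int
  assumes "degree g > 0" and "r \<ge> 1"
    and roots: "\<And>z. poly (map_poly of_int g) z = 0 \<Longrightarrow> cmod (of_int m - z) > r"
  shows "\<bar>of_int (poly g m)\<bar> > r ^ degree g"
proof -
  define G :: "complex poly" where "G = map_poly of_int g"
  have deg: "degree G = degree g" and lc: "lead_coeff G = of_int (lead_coeff g)"
    by (simp_all add: G_def degree_map_poly coeff_map_poly)
  obtain A where A: "size A = degree G" "G = smult (lead_coeff G) (\<Prod>z\<in>#A. [:-z, 1:])"
    using alg_closed_imp_factorization[of G] deg assms(1) by fastforce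
  have "poly G (of_int m) = of_int (poly g m)"
    unfolding G_def by (induction g) (simp_all add: map_poly_pCons)
  \<comment> \<open>Kept for arbitrary \<open>x\<close>: it is used at \<open>m\<close> for the
    value, and at each \<open>z\<close> in \<open>A\<close> to see that \<open>z\<close> is a
    root.\<close>
  moreover have ev: "poly G x = lead_coeff G * (\<Prod>z\<in>#A. x - z)" for x
    by (subst A(2)) (simp add: poly_prod_mset image_mset.compositionality o_def)
  moreover have "cmod (\<Prod>z\<in>#A. of_int m - z) = (\<Prod>z\<in>#A. cmod (of_int m - z))"
    by (induction A) (simp_all add: norm_mult)
  ultimately have eq: "\<bar>of_int (poly g m)\<bar>
      = \<bar>of_int (lead_coeff g)\<bar> * (\<Prod>z\<in>#A. cmod (of_int m - z))"
    by (metis lc norm_mult norm_of_int)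
  have "poly G z = 0" if "z \<in># A" for z
    using that by (simp add: ev image_iff)
  moreover have "A \<noteq> {#}" using A(1) deg assms(1) by auto
  ultimately have "r ^ degree g < (\<Prod>z\<in>#A. cmod (of_int m - z))"
    using prod_mset_norm_gt[of r A "of_int m"] roots assms A(1) deg by (auto simp: G_def)
  moreover have "r ^ degree g > 0" using \<open>r \<ge> 1\<close> by simp
  moreover have "\<bar>of_int (lead_coeff g)\<bar> \<ge> (1 :: real)"
    using assms(1) by (intro Ints_nonzero_abs_ge1) auto
  ultimately have "1 * r ^ degree g < \<bar>of_int (lead_coeff g)\<bar> * (\<Prod>z\<in>#A. cmod (of_int m - z))"
    by (intro mult_le_less_imp_less) auto
  thus ?thesis by (simp only: eq mult_1)
qed

lemma rat_poly_clear_denominators: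
  fixes g :: "rat poly"
  obtains d :: int and G :: "int poly" where "d > 0" "map_poly of_int G = smult (of_int d) g"
proof -
  have "\<exists>d>0. \<exists>G. map_poly of_int G = smult (of_int d) g"
  proof (induction g)
    case 0
    show ?case by (rule exI[of _ 1]) (auto intro: exI[of _ 0])
  next
    case (pCons a g)
    obtain d G where d: "d > 0" and G: "map_poly of_int G = smult (of_int d) g"
      using pCons.IH by blast
    obtain n k where a: "a = of_int n / of_int k" and "k > 0"
      by (metis quotient_of_div quotient_of_denom_pos surj_pair)
    \<comment> \<open>With \<open>a = n / k\<close>, the common denominator \<open>k * d\<close>
      turns \<open>a\<close> into the integer \<open>n * d\<close>.\<close>
    have "map_poly of_int (pCons (n * d) (smult k G)) = smult (of_int (k * d)) (pCons a g)"
      using \<open>k > 0\<close> G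
      by (simp add: a map_poly_pCons map_poly_smult mult.assoc flip: smult_smult)
    thus ?case using d \<open>k > 0\<close> by (metis mult_pos_pos)
  qed
  thus ?thesis using that by blast
qed

text \<open>This is Gauss' lemma: a rational factorisation, cleared of denominators, yields an
  integer one with factors of the same degrees, because primitive parts multiply. Over the rationals
  a nonzero factor of degree 0 is a unit.\<close>

lemma irreducible_rat_polyI:
  fixes f :: "int poly"
  assumes "degree f > 0" and factors: "\<And>g h. f = g * h \<Longrightarrow> degree g = 0 \<or> degree h = 0"
  shows "irreducible (map_poly (of_int :: int \<Rightarrow> rat) f)"
proof (rule irreducibleI)
  define F where "F = map_poly (of_int :: int \<Rightarrow> rat) f"
  have degF: "degree F = degree f" by (simp add: F_def degree_map_poly)
  hence "F \<noteq> 0" using assms(1) by auto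
  thus "map_poly (of_int :: int \<Rightarrow> rat) f \<noteq> 0" "\<not> is_unit (map_poly (of_int :: int \<Rightarrow> rat) f)"
    using degF assms(1) unfolding F_def[symmetric] by (simp_all add: is_unit_iff_degree)
  fix g h assume gh: "map_poly (of_int :: int \<Rightarrow> rat) f = g * h"
  hence nz: "g \<noteq> 0" "h \<noteq> 0"
    using \<open>F \<noteq> 0\<close> unfolding F_def by auto
  obtain d G where d: "d > 0" and G: "map_poly of_int G = smult (of_int d) g"
    by (rule rat_poly_clear_denominators)
  obtain e H where e: "e > 0" and H: "map_poly of_int H = smult (of_int e) h"
    by (rule rat_poly_clear_denominators)
  have inj: "p = q" if "map_poly (of_int :: int \<Rightarrow> rat) p = map_poly of_int q" for p q
    using that by (simp add: poly_eq_iff coeff_map_poly)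
  have "map_poly (of_int :: int \<Rightarrow> rat) (G * H) = map_poly of_int G * map_poly of_int H"
    by (simp add: poly_eq_iff coeff_map_poly coeff_mult)
  also have "\<dots> = map_poly of_int (smult (d * e) f)"
    by (simp add: G H gh map_poly_smult mult.commute)
  finally have "smult (d * e) f = G * H" by (intro inj) simp
  hence "primitive_part (smult (d * e) f) = primitive_part G * primitive_part H"
    by (simp add: primitive_part_mult)
  \<comment> \<open>Since \<open>d * e\<close> is positive, it disappears from the primitive part
    without leaving a sign.\<close>
  hence "primitive_part f = primitive_part G * primitive_part H"
    using d e by (simp add: primitive_part_smult)
  \<comment> \<open>The content of \<open>f\<close> is put back into one factor, so that
    \<open>f\<close> itself is factored over the integers.\<close>
  hence "f = smult (content f) (primitive_part G) * primitive_part H"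
    by (metis content_times_primitive_part mult_smult_left)
  hence "degree (smult (content f) (primitive_part G)) = 0 \<or> degree (primitive_part H) = 0"
    by (rule factors)
  moreover have "content f \<noteq> 0" using assms(1) by auto
  ultimately have "degree G = 0 \<or> degree H = 0" by simp
  moreover have "degree (map_poly (of_int :: int \<Rightarrow> rat) G) = degree g"
    using d by (simp add: G)
  moreover have "degree (map_poly (of_int :: int \<Rightarrow> rat) H) = degree h"
    using e by (simp add: H)
  ultimately have "degree g = 0 \<or> degree h = 0" by (simp add: degree_map_poly)
  thus "is_unit g \<or> is_unit h" using nz by (simp add: is_unit_iff_degree)
qed

text \<open>The common core of both claims: \<open>k\<close> bounds the degrees of nonconstant
  factors from below, and is used as \<open>k = 1\<close> with \<open>r = q\<close> and as
  \<open>k = 2\<close> with \<open>r = sqrt q\<close>.\<close>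

lemma irreducible_if_roots_far:
  fixes f :: "int poly" and p q m :: int
  assumes "degree f > 0" and "prime p" and "q > 0" and "poly f m = p * q"
    and "r \<ge> 1" and "of_int q \<le> r ^ k"
    and roots: "\<And>z. poly (map_poly of_int f) z = 0 \<Longrightarrow> cmod (of_int m - z) > r"
    and deg: "\<And>g. g dvd f \<Longrightarrow> degree g > 0 \<Longrightarrow> degree g \<ge> k"
  shows "irreducible (map_poly (of_int :: int \<Rightarrow> rat) f)"
proof (rule irreducible_rat_polyI)
  have no_factor: False if f: "f = g * h" and "degree g > 0" and "p dvd poly h m" for g h
  proof -
    obtain s where s: "poly h m = p * s" using \<open>p dvd poly h m\<close> by (elim dvdE)
    have "p * (poly g m * s) = p * q"
      using assms(4) by (simp add: f s algebra_simps)
    \<comment> \<open>As \<open>p\<close> is absorbed by \<open>h\<close>, the value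
      \<open>poly g m\<close> divides \<open>q\<close>; its absolute value is then at most
      \<open>q\<close>, hence at most \<open>r ^ degree g\<close>, against the lower bound from the
      roots.\<close>
    hence "poly g m * s = q" using \<open>prime p\<close> by auto
    hence "\<bar>poly g m\<bar> \<le> q" using \<open>q > 0\<close> by (metis dvd_triv_left zdvd_imp_le abs_dvd_iff)
    hence "\<bar>of_int (poly g m)\<bar> \<le> r ^ k" using assms(6) by linarith
    also have "\<dots> \<le> r ^ degree g"
      using deg[of g] that \<open>r \<ge> 1\<close> by (intro power_increasing) auto
    also have "\<dots> < \<bar>of_int (poly g m)\<bar>"
    proof (rule abs_poly_gt_power)
      fix z :: complex assume "poly (map_poly of_int g) z = 0"
      moreover have "map_poly (of_int :: int \<Rightarrow> complex) f = map_poly of_int g * map_poly of_int h"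
        by (simp add: f poly_eq_iff coeff_map_poly coeff_mult)
      ultimately show "cmod (of_int m - z) > r" by (intro roots) simp
    qed (use that \<open>r \<ge> 1\<close> in auto)
    finally show False by simp
  qed
  fix g h assume f: "f = g * h"
  have "p dvd poly g m * poly h m" using assms(4) by (simp add: f)
  hence "p dvd poly g m \<or> p dvd poly h m"
    using \<open>prime p\<close> by (simp add: prime_dvd_mult_iff)
  thus "degree g = 0 \<or> degree h = 0"
    using no_factor[of g h] no_factor[of h g] f by (auto simp: mult.commute)
qed fact

text \<open>A linear factor \<open>[:b, a:]\<close> would give \<open>f\<close> the rational root
  \<open>- b / a\<close>.\<close>

lemma degree_factor_ge_2:
  fixes f g :: "int poly"
  assumes "\<And>x :: rat. poly (map_poly of_int f) x \<noteq> 0" and "g dvd f" and "degree g > 0"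
  shows "degree g \<ge> 2"
proof (rule ccontr)
  assume "\<not> degree g \<ge> 2"
  hence "degree g = 1" using assms(3) by simp
  then obtain a b where g: "g = [:b, a:]" and "a \<noteq> 0"
    by (metis degree_eq_zeroE degree_pCons_eq_if one_neq_zero pCons_cases pCons_0_0
        One_nat_def diff_Suc_1)
  obtain h where f: "f = g * h" using assms(2) by (elim dvdE)
  have "map_poly (of_int :: int \<Rightarrow> rat) f = map_poly of_int g * map_poly of_int h"
    by (simp add: f poly_eq_iff coeff_map_poly coeff_mult)
  moreover have "poly (map_poly of_int g) (- of_int b / of_int a :: rat) = 0"
    using \<open>a \<noteq> 0\<close> by (simp add: g map_poly_pCons)
  ultimately show False using assms(1) by (metis mult_zero_left poly_mult)
qed

theorem theorem3p1:
  fixes f :: "int poly" and v \<theta> :: real and p q m :: int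
  assumes "degree f > 0"
    and "0 < \<theta>" and "\<theta> \<le> pi / 2"
    and "\<forall>z \<in> sector v \<theta>. poly (map_poly (of_int :: int \<Rightarrow> complex) f) z \<noteq> 0"
    and "prime p" and "q > 0" and "poly f m = p * q"
  shows "(real_of_int m > v + real_of_int q / sin \<theta> \<longrightarrow>
            irreducible (map_poly (of_int :: int \<Rightarrow> rat) f))
       \<and> ((\<forall>x :: rat. poly (map_poly (of_int :: int \<Rightarrow> rat) f) x \<noteq> 0) \<and>
          real_of_int m > v + sqrt (real_of_int q) / sin \<theta> \<longrightarrow>
            irreducible (map_poly (of_int :: int \<Rightarrow> rat) f))"
proof -
  have "sin \<theta> > 0" using assms(2,3) pi_gt_zero by (intro sin_gt_zero) linarith+
  \<comment> \<open>Left general in \<open>r\<close>, to serve for both \<open>q\<close> and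
    \<open>sqrt q\<close>; the bound on \<open>m\<close> is exactly
    \<open>r < (m - v) * sin \<theta>\<close>.\<close>
  have far: "cmod (of_int m - z) > r"
    if "r \<ge> 1" "real_of_int m > v + r / sin \<theta>" "poly (map_poly of_int f) z = 0" for r z
  proof -
    have "r / sin \<theta> > 0" using that \<open>sin \<theta> > 0\<close> by simp
    hence "of_int m > v" using that by linarith
    hence "(of_int m - v) * sin \<theta> \<le> cmod (of_int m - z)"
      using dist_outside_sector[of v "of_int m" \<theta> z] assms(2-4) that(3) by auto
    moreover have "r < (of_int m - v) * sin \<theta>"
      using that(2) \<open>sin \<theta> > 0\<close> by (simp add: field_simps)
    ultimately show ?thesis by linarith
  qed
  have q: "real_of_int q \<ge> 1" using \<open>q > 0\<close> by simp
  show ?thesis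
  proof (intro conjI impI)
    assume "real_of_int m > v + real_of_int q / sin \<theta>"
    thus "irreducible (map_poly (of_int :: int \<Rightarrow> rat) f)"
      using q far by (intro irreducible_if_roots_far[OF assms(1,5-7), where k = 1 and r = "of_int q"]) auto
  next
    assume "(\<forall>x :: rat. poly (map_poly (of_int :: int \<Rightarrow> rat) f) x \<noteq> 0) \<and>
            real_of_int m > v + sqrt (real_of_int q) / sin \<theta>"
    thus "irreducible (map_poly (of_int :: int \<Rightarrow> rat) f)"
      using q far degree_factor_ge_2[of f]
      by (intro irreducible_if_roots_far[OF assms(1,5-7), where k = 2 and r = "sqrt (of_int q)"]) auto
  qed
qed

end
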